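(* Let $m\ge 2$ and let $v,w\in(R_\infty)^m$, where $R_\infty=(\mathbb{Z},* )$ with $a*b=2b-a$. The following are equivalent. (1) There exists an $m$-braid $\beta\in B_m$ such that $v\cdot\beta=w$. (2) $\Delta(v)=\Delta(w)$, $d(v)=d(w)$, and $M(v)=M(w)$.
   Context: The universal dihedral quandle $R_\infty$ is the set $\mathbb{Z}$ with operation $a*b=2b-a$; thus $(R_\infty)^m=\mathbb{Z}^m$ as a set. $B_m$ is the $m$-braid group with standard generators $\sigma_1,\dots,\sigma_{m-1}$ (relations $\sigma_i\sigma_j=\sigma_j\sigma_i$ for $|i-j|\ge2$ and $\sigma_i\sigma_{i+1}\sigma_i=\sigma_{i+1}\sigma_i\sigma_{i+1}$). The Hurwitz action is the right action of $B_m$ on $\mathbb{Z}^m$ given by $(a_1,\dots,a_i,a_{i+1},\dots,a_m)\cdot\sigma_i=(a_1,\dots,a_{i-1},a_{i+1},2a_{i+1}-a_i,a_{i+2},\dots,a_m)$. For $v=(a_1,\dots,a_m)\in\mathbb{Z}^m$: $v$ is trivial if $a_1=\dots=a_m$, and nontrivial otherwise. $\Delta(v)=\sum_{i=1}^m(-1)^{i-1}a_i$. $d(v)=0$ if $v$ is trivial, and $d(v)=\gcd\{a_i-a_j\mid 1\le i,j\le m\}>0$ if $v$ is nontrivial. $M(v)$ is the multiset (unordered $m$-tuple) of the congruence classes of $a_1,\dots,a_m$ modulo $2d(v)$, with the convention that if $d(v)=0$, the class of $a_i$ is the integer $a_i$ itself. *)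

theory Defs
  imports "HOL-Algebra.Group" "HOL-Library.Multiset" "HOL-Number_Theory.Cong"
begin

section \<open>Groups given by generators and relations\<close>

text \<open>The letter \<open>(s, True)\<close> stands for the generator \<open>s\<close>, the letter \<open>(s, False)\<close> for its
  formal inverse. The group is the set of words over \<open>S\<close> modulo the least congruence that
  contains free cancellation and the relators.\<close>

type_synonym 's gword = "('s \<times> bool) list"

definition gwords :: "'s set \<Rightarrow> 's gword set" where
  "gwords S = lists (S \<times> UNIV)"

inductive pres_eq :: "'s set \<Rightarrow> ('s gword \<times> 's gword) set \<Rightarrow> 's gword \<Rightarrow> 's gword \<Rightarrow> bool"
  for S R where
    refl: "u \<in> gwords S \<Longrightarrow> pres_eq S R u u"
  | sym: "pres_eq S R u v \<Longrightarrow> pres_eq S R v u"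
  | trans: "pres_eq S R u v \<Longrightarrow> pres_eq S R v w \<Longrightarrow> pres_eq S R u w"
  | append: "pres_eq S R u u' \<Longrightarrow> pres_eq S R v v' \<Longrightarrow> pres_eq S R (u @ v) (u' @ v')"
  | cancel: "s \<in> S \<Longrightarrow> pres_eq S R [(s, b), (s, \<not> b)] []"
  | relator: "(u, v) \<in> R \<Longrightarrow> u \<in> gwords S \<Longrightarrow> v \<in> gwords S \<Longrightarrow> pres_eq S R u v"

definition pres_rel :: "'s set \<Rightarrow> ('s gword \<times> 's gword) set \<Rightarrow> ('s gword \<times> 's gword) set" where
  "pres_rel S R = {(u, v). pres_eq S R u v}"

definition presented_group :: "'s set \<Rightarrow> ('s gword \<times> 's gword) set \<Rightarrow> 's gword set monoid" where
  "presented_group S R =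
    \<lparr>carrier = gwords S // pres_rel S R,
     monoid.mult = (\<lambda>A B. \<Union>u\<in>A. \<Union>v\<in>B. pres_rel S R `` {u @ v}),
     one = pres_rel S R `` {[]}\<rparr>"

lemma pres_eq_gwords: "pres_eq S R u v \<Longrightarrow> u \<in> gwords S \<and> v \<in> gwords S"
  by (induction rule: pres_eq.induct) (auto simp: gwords_def)

lemma equiv_pres_rel: "equiv (gwords S) (pres_rel S R)"
  by (rule equivI)
    (auto simp: refl_on_def sym_def trans_def pres_rel_def
      intro: pres_eq.refl pres_eq.sym pres_eq.trans dest: pres_eq_gwords)

lemma presented_group_mult:
  assumes "u \<in> gwords S" "v \<in> gwords S"
  shows "(pres_rel S R `` {u}) \<otimes>\<^bsub>presented_group S R\<^esub> (pres_rel S R `` {v}) = pres_rel S R `` {u @ v}"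
proof -
  have "congruent2 (pres_rel S R) (pres_rel S R) (\<lambda>u v. pres_rel S R `` {u @ v})"
    by (intro congruent2I' equiv_class_eq[OF equiv_pres_rel])
      (auto simp: pres_rel_def intro: pres_eq.append)
  then show ?thesis
    using UN_equiv_class2[OF equiv_pres_rel equiv_pres_rel _ assms]
    by (simp add: presented_group_def)
qed

lemma pres_eq_inverse:
  "u \<in> gwords S \<Longrightarrow> pres_eq S R (rev (map (\<lambda>(s, b). (s, \<not> b)) u) @ u) []"
proof (induction u)
  case Nil
  then show ?case by (simp add: pres_eq.refl)
next
  case (Cons x u)
  obtain s b where x: "x = (s, b)" by (cases x)
  let ?i = "rev (map (\<lambda>(s, b). (s, \<not> b)) u)"
  have s: "s \<in> S" and u: "u \<in> gwords S" using Cons.prems x by (auto simp: gwords_def)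
  have i: "?i \<in> gwords S" using u by (auto simp: gwords_def)
  have "pres_eq S R ([(s, \<not> b), (s, b)] @ u) ([] @ u)"
    using pres_eq.cancel[OF s, of R "\<not> b"] u by (intro pres_eq.append pres_eq.refl) auto
  then have "pres_eq S R (?i @ [(s, \<not> b), (s, b)] @ u) (?i @ [] @ u)"
    using i by (intro pres_eq.append[OF pres_eq.refl])
  then show ?case using Cons.IH[OF u] x by (auto intro: pres_eq.trans)
qed

lemma group_presented_group: "group (presented_group S R)"
proof (rule groupI)
  note E = equiv_pres_rel[of S R] and M = presented_group_mult[of _ S _ R]
  have N: "[] \<in> gwords S" by (simp add: gwords_def)
  have A: "u @ v \<in> gwords S" if "u \<in> gwords S" "v \<in> gwords S" for u v
    using that by (simp add: gwords_def)
  have C: "carrier (presented_group S R) = gwords S // pres_rel S R"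
    and O: "\<one>\<^bsub>presented_group S R\<^esub> = pres_rel S R `` {[]}"
    by (simp_all add: presented_group_def)
  fix x assume x: "x \<in> carrier (presented_group S R)"
  then obtain u where u: "u \<in> gwords S" "x = pres_rel S R `` {u}" by (auto simp: C elim: quotientE)
  show "\<one>\<^bsub>presented_group S R\<^esub> \<otimes>\<^bsub>presented_group S R\<^esub> x = x"
    using M[OF N u(1)] u by (simp add: O)
  let ?i = "rev (map (\<lambda>(s, b). (s, \<not> b)) u)"
  have i: "?i \<in> gwords S" using u by (auto simp: gwords_def)
  show "\<exists>y\<in>carrier (presented_group S R). y \<otimes>\<^bsub>presented_group S R\<^esub> x = \<one>\<^bsub>presented_group S R\<^esub>"
  proof
    show "pres_rel S R `` {?i} \<in> carrier (presented_group S R)" using i by (auto simp: C intro: quotientI)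
    show "pres_rel S R `` {?i} \<otimes>\<^bsub>presented_group S R\<^esub> x = \<one>\<^bsub>presented_group S R\<^esub>"
      unfolding u(2) M[OF i u(1)] O
      by (rule equiv_class_eq[OF E]) (use pres_eq_inverse[OF u(1)] in \<open>simp add: pres_rel_def\<close>)
  qed
  fix y assume "y \<in> carrier (presented_group S R)"
  then obtain v where v: "v \<in> gwords S" "y = pres_rel S R `` {v}" by (auto simp: C elim: quotientE)
  show "x \<otimes>\<^bsub>presented_group S R\<^esub> y \<in> carrier (presented_group S R)"
    using M[OF u(1) v(1)] u v A by (auto simp: C intro: quotientI)
  fix z assume "z \<in> carrier (presented_group S R)"
  then obtain w where w: "w \<in> gwords S" "z = pres_rel S R `` {w}" by (auto simp: C elim: quotientE)
  show "x \<otimes>\<^bsub>presented_group S R\<^esub> y \<otimes>\<^bsub>presented_group S R\<^esub> z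
      = x \<otimes>\<^bsub>presented_group S R\<^esub> (y \<otimes>\<^bsub>presented_group S R\<^esub> z)"
    using u v w by (simp add: M A)
next
  show "\<one>\<^bsub>presented_group S R\<^esub> \<in> carrier (presented_group S R)"
    by (auto simp: presented_group_def gwords_def intro: quotientI)
qed


section \<open>The braid group\<close>

abbreviation sigma :: "nat \<Rightarrow> nat \<times> bool" where
  "sigma i \<equiv> (i, True)"

definition braid_relators :: "nat \<Rightarrow> (nat gword \<times> nat gword) set" where
  "braid_relators m =
     {([sigma i, sigma j], [sigma j, sigma i]) | i j.
        i \<in> {1..<m} \<and> j \<in> {1..<m} \<and> \<bar>int i - int j\<bar> \<ge> 2}
   \<union> {([sigma i, sigma (i + 1), sigma i], [sigma (i + 1), sigma i, sigma (i + 1)]) | i.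
        i \<in> {1..<m} \<and> i + 1 \<in> {1..<m}}"

definition braid_group :: "nat \<Rightarrow> nat gword set monoid" where
  "braid_group m = presented_group {1..<m} (braid_relators m)"


section \<open>The universal dihedral quandle and the Hurwitz action\<close>

definition rinf_op :: "int \<Rightarrow> int \<Rightarrow> int"  (infixl "\<triangleright>" 65) where
  "a \<triangleright> b = 2 * b - a"

definition rinf_pow :: "nat \<Rightarrow> int list set" where
  "rinf_pow m = {v. length v = m}"

text \<open>The entry \<open>a\<^sub>i\<close> of an \<open>m\<close>-tuple \<open>v\<close> is \<open>v ! (i - 1)\<close>. The inverse generator uses
  that \<open>x \<mapsto> x \<triangleright> a\<close> is an involution, see \<open>hurwitz_letter_inverse\<close> below.\<close>

fun hurwitz_letter :: "int list \<Rightarrow> nat \<times> bool \<Rightarrow> int list" where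
  "hurwitz_letter v (i, True) =
     v[i - 1 := v ! i, i := v ! (i - 1) \<triangleright> v ! i]"
| "hurwitz_letter v (i, False) =
     v[i - 1 := v ! i \<triangleright> v ! (i - 1), i := v ! (i - 1)]"

definition hurwitz_word :: "int list \<Rightarrow> nat gword \<Rightarrow> int list" where
  "hurwitz_word v u = foldl hurwitz_letter v u"

text \<open>Any word representing \<open>\<beta>\<close> may be chosen; see \<open>hurwitz_class\<close> and \<open>hurwitz_mult\<close> below
  for independence of the choice and the right action property.\<close>

definition hurwitz :: "int list \<Rightarrow> nat gword set \<Rightarrow> int list"  (infixl "\<cdot>\<^sub>H" 65) where
  "v \<cdot>\<^sub>H \<beta> = hurwitz_word v (SOME u. u \<in> \<beta>)"

lemma length_hurwitz_letter [simp]: "length (hurwitz_letter v x) = length v"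
  by (cases "(v, x)" rule: hurwitz_letter.cases) auto

lemma length_hurwitz_word [simp]: "length (hurwitz_word v u) = length v"
  unfolding hurwitz_word_def by (induction u arbitrary: v) auto

lemma hurwitz_word_append: "hurwitz_word v (u @ u') = hurwitz_word (hurwitz_word v u) u'"
  by (simp add: hurwitz_word_def)

lemma hurwitz_letter_inverse:
  assumes "length v = m" "i \<in> {1..<m}"
  shows "hurwitz_letter (hurwitz_letter v (i, b)) (i, \<not> b) = v"
  using assms by (cases b) (auto simp: rinf_op_def list_eq_iff_nth_eq nth_list_update)

lemma hurwitz_relator:
  assumes "(u, u') \<in> braid_relators m" "length v = m"
  shows "hurwitz_word v u = hurwitz_word v u'"
  using assms unfolding braid_relators_def
  by (auto simp: hurwitz_word_def rinf_op_def nth_list_update intro!: nth_equalityI)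

lemma hurwitz_pres_eq:
  assumes "pres_eq {1..<m} (braid_relators m) u u'" "length v = m"
  shows "hurwitz_word v u = hurwitz_word v u'"
  using assms
proof (induction arbitrary: v rule: pres_eq.induct)
  case (cancel s b)
  then show ?case using hurwitz_letter_inverse[of v m s b] by (simp add: hurwitz_word_def)
qed (simp_all add: hurwitz_word_append hurwitz_relator)

lemma hurwitz_class:
  assumes "\<beta> \<in> carrier (braid_group m)" "u \<in> \<beta>" "v \<in> rinf_pow m"
  shows "v \<cdot>\<^sub>H \<beta> = hurwitz_word v u"
proof -
  have "(SOME u. u \<in> \<beta>) \<in> \<beta>" using assms(2) by (rule someI)
  then have "((SOME u. u \<in> \<beta>), u) \<in> pres_rel {1..<m} (braid_relators m)"
    using assms quotient_eq_iff[OF equiv_pres_rel, of \<beta> _ _ \<beta>]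
    by (auto simp: braid_group_def presented_group_def)
  then show ?thesis
    using hurwitz_pres_eq assms(3) by (auto simp: hurwitz_def pres_rel_def rinf_pow_def)
qed

lemma hurwitz_mult:
  assumes "\<alpha> \<in> carrier (braid_group m)" "\<beta> \<in> carrier (braid_group m)" "v \<in> rinf_pow m"
  shows "v \<cdot>\<^sub>H (\<alpha> \<otimes>\<^bsub>braid_group m\<^esub> \<beta>) = v \<cdot>\<^sub>H \<alpha> \<cdot>\<^sub>H \<beta>"
proof -
  let ?r = "pres_rel {1..<m} (braid_relators m)" and ?W = "gwords {1..<m}"
  obtain u u' where u: "u \<in> ?W" "\<alpha> = ?r `` {u}" and u': "u' \<in> ?W" "\<beta> = ?r `` {u'}"
    using assms by (auto simp: braid_group_def presented_group_def elim!: quotientE)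
  have m: "\<alpha> \<otimes>\<^bsub>braid_group m\<^esub> \<beta> = ?r `` {u @ u'}"
    unfolding braid_group_def u(2) u'(2) by (rule presented_group_mult[OF u(1) u'(1)])
  have uu: "u @ u' \<in> ?W" using u u' by (simp add: gwords_def)
  have c: "?r `` {x} \<in> carrier (braid_group m)" "x \<in> ?r `` {x}" if "x \<in> ?W" for x
    using that equiv_class_self[OF equiv_pres_rel that]
    by (auto simp: braid_group_def presented_group_def intro: quotientI)
  have l: "hurwitz_word v u \<in> rinf_pow m" using assms(3) by (simp add: rinf_pow_def)
  show ?thesis
    using hurwitz_class[OF c[OF uu] assms(3)] hurwitz_class[OF c[OF u(1)] assms(3)]
      hurwitz_class[OF c[OF u'(1)] l]
    by (simp only: m[unfolded u(2) u'(2)] u(2) u'(2) hurwitz_word_append)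
qed


section \<open>The invariants\<close>

definition trivial_tuple :: "int list \<Rightarrow> bool" where
  "trivial_tuple v \<longleftrightarrow> (\<forall>i<length v. \<forall>j<length v. v ! i = v ! j)"

definition Delta :: "int list \<Rightarrow> int" where
  "Delta v = (\<Sum>i = 1..length v. (- 1) ^ (i - 1) * v ! (i - 1))"

definition tuple_gcd :: "int list \<Rightarrow> int" where
  "tuple_gcd v = (if trivial_tuple v then 0
     else Gcd {v ! i - v ! j | i j. i < length v \<and> j < length v})"

text \<open>For \<open>n = 0\<close> the class of \<open>a\<close> is the singleton \<open>{a}\<close>, standing for the integer \<open>a\<close> itself.\<close>

definition cong_class :: "int \<Rightarrow> int \<Rightarrow> int set" where
  "cong_class n a = {b. [b = a] (mod n)}"

definition class_mset :: "int list \<Rightarrow> int set multiset" where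
  "class_mset v = image_mset (cong_class (2 * tuple_gcd v)) (mset v)"

end

theory Submission
  imports Defs
begin

text \<open>
  A pair \<open>x, x\<close> of equal adjacent entries can be moved anywhere in a tuple, and it can be reflected
  about any other entry \<open>a\<close>, that is, replaced by \<open>2a - x, 2a - x\<close>. On a triple, the braid group
  acts on the two consecutive differences through Euclid's algorithm, so every tuple is equivalent
  to a sequence of pairs followed by one or two entries. In odd length the last entry is \<open>\<Delta>\<close>, and
  reflections reduce every pair to \<open>\<Delta>\<close> or \<open>\<Delta> + d\<close>; the class multiset counts how often each occurs.

  In even length at least 4, both tuples are brought to a form with the same first entry \<open>x\<close> and a
  tail that still has gcd \<open>d\<close>; then the odd case applies to the tails. Moving the first entry
  through the normal form of its tail and reflecting pairs about it changes \<open>x\<close> by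
  \<open>\<plusminus> \<Delta> \<plusminus> d\<close>, hence by all multiples of \<open>2d\<close>; the other class modulo \<open>2d\<close> is reached whenever
  it contains at least two entries.
\<close>

section \<open>Equivalence under the Hurwitz action\<close>

text \<open>One positive generator at an arbitrary position is enough: inverse generators come from
  symmetry and words from transitivity. The classes are thus the orbits, and later arguments never
  name a group element.\<close>

inductive hurwitz_eq :: "int list \<Rightarrow> int list \<Rightarrow> bool" (infix "\<sim>" 50) where
  heq_refl: "v \<sim> v"
| heq_sym: "v \<sim> w \<Longrightarrow> w \<sim> v"
| heq_trans [trans]: "u \<sim> v \<Longrightarrow> v \<sim> w \<Longrightarrow> u \<sim> w"
| heq_step: "p @ [a, b] @ s \<sim> p @ [b, 2 * b - a] @ s"

lemma heq_context:
  assumes "v \<sim> w"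
  shows "p @ v @ s \<sim> p @ w @ s"
  using assms
proof induction
  case (heq_step q a b t)
  show ?case using hurwitz_eq.heq_step[of "p @ q" a b "t @ s"] by simp
qed (auto intro: hurwitz_eq.intros)

lemma heq_append_left: "v \<sim> w \<Longrightarrow> p @ v \<sim> p @ w"
  using heq_context[of v w p "[]"] by simp

lemma heq_append_right: "v \<sim> w \<Longrightarrow> v @ s \<sim> w @ s"
  using heq_context[of v w "[]" s] by simp

lemma heq_Cons: "v \<sim> w \<Longrightarrow> a # v \<sim> a # w"
  using heq_append_left[of v w "[a]"] by simp

lemma heq_length: "v \<sim> w \<Longrightarrow> length v = length w"
  by (induction rule: hurwitz_eq.induct) auto

lemma heq_hurwitz_letter:
  assumes "i \<in> {1..<length v}"
  shows "v \<sim> hurwitz_letter v (i, b)"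
proof -
  have up: "v \<sim> hurwitz_letter v (i, True)" if i: "i \<in> {1..<length v}" for v
  proof -
    define p s where "p = take (i - 1) v" and "s = drop (i + 1) v"
    have v: "v = p @ [v ! (i - 1), v ! i] @ s"
      using i id_take_nth_drop[of "i - 1" v] Cons_nth_drop_Suc[of i v]
      by (auto simp: p_def s_def)
    have p: "length p = i - 1" using i by (auto simp: p_def)
    obtain a b where "v = p @ [a, b] @ s" using v by blast
    moreover have "hurwitz_letter (p @ [a, b] @ s) (i, True) = p @ [b, 2 * b - a] @ s"
      using i p by (auto simp: list_update_append nth_append rinf_op_def nth_Cons'
          split: nat.splits)
    ultimately show ?thesis using heq_step[of p a b s] by (simp only:)
  qed
  show ?thesis
  proof (cases b)
    case False
    \<comment> \<open>The generator undoes its inverse, so \<open>up\<close> is applied to the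
      image.\<close>
    have "hurwitz_letter v (i, False) \<sim> v"
      using up[of "hurwitz_letter v (i, False)"] hurwitz_letter_inverse[of v "length v" i False]
        assms length_hurwitz_letter[of v "(i, False)"] by simp
    then show ?thesis using False by (simp add: heq_sym)
  qed (use up assms in simp)
qed

lemma heq_hurwitz_word:
  assumes "u \<in> gwords {1..<length v}"
  shows "v \<sim> hurwitz_word v u"
  using assms
proof (induction u arbitrary: v)
  case (Cons x u)
  obtain i b where x: "x = (i, b)" by (cases x)
  have "v \<sim> hurwitz_letter v x"
    using Cons.prems by (auto simp: x gwords_def intro!: heq_hurwitz_letter)
  also have "\<dots> \<sim> hurwitz_word (hurwitz_letter v x) u"
    using Cons.prems by (intro Cons.IH) (simp add: gwords_def)
  finally show ?case by (simp add: hurwitz_word_def)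
qed (simp add: hurwitz_word_def heq_refl)

lemma hurwitz_word_inverse:
  assumes "u \<in> gwords {1..<length v}"
  shows "hurwitz_word (hurwitz_word v u) (rev (map (\<lambda>(s, b). (s, \<not> b)) u)) = v"
  using assms
proof (induction u arbitrary: v)
  case (Cons x u)
  obtain i b where x: "x = (i, b)" by (cases x)
  have "hurwitz_word (hurwitz_word (hurwitz_letter v x) u) (rev (map (\<lambda>(s, b). (s, \<not> b)) u))
      = hurwitz_letter v x"
    using Cons.prems by (intro Cons.IH) (simp add: gwords_def)
  then show ?case
    using Cons.prems hurwitz_letter_inverse[of v "length v" i b]
    by (auto simp: x gwords_def hurwitz_word_def)
qed (simp add: hurwitz_word_def)

lemma heq_imp_hurwitz_word:
  assumes "v \<sim> w"
  shows "\<exists>u\<in>gwords {1..<length v}. hurwitz_word v u = w"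
  using assms
proof induction
  case (heq_refl v)
  show ?case by (intro bexI[of _ "[]"]) (auto simp: hurwitz_word_def gwords_def)
next
  case (heq_sym v w)
  then obtain u where u: "u \<in> gwords {1..<length v}" "hurwitz_word v u = w" by blast
  show ?case
  proof (intro bexI)
    show "hurwitz_word w (rev (map (\<lambda>(s, b). (s, \<not> b)) u)) = v"
      using u hurwitz_word_inverse[OF u(1)] by simp
    show "rev (map (\<lambda>(s, b). (s, \<not> b)) u) \<in> gwords {1..<length w}"
      using u(1) unfolding gwords_def heq_length[OF heq_sym(1), symmetric] by (induction u) auto
  qed
next
  case (heq_trans u v w)
  then obtain x y where "x \<in> gwords {1..<length u}" "hurwitz_word u x = v"
    "y \<in> gwords {1..<length v}" "hurwitz_word v y = w" by blast
  then show ?case using heq_length[OF heq_trans(1)]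
    by (intro bexI[of _ "x @ y"]) (auto simp: gwords_def hurwitz_word_append)
next
  case (heq_step p a b s)
  show ?case
    \<comment> \<open>Generators are numbered from 1, so the one acting on the two entries right
      after \<open>p\<close> has index \<open>length p + 1\<close>.\<close>
    by (intro bexI[of _ "[(length p + 1, True)]"])
      (auto simp: hurwitz_word_def gwords_def list_update_append nth_append rinf_op_def)
qed

lemma hurwitz_orbit_iff_heq:
  assumes "v \<in> rinf_pow m"
  shows "(\<exists>\<beta>\<in>carrier (braid_group m). v \<cdot>\<^sub>H \<beta> = w) \<longleftrightarrow> v \<sim> w"
proof
  have m: "length v = m" using assms by (simp add: rinf_pow_def)
  let ?r = "pres_rel {1..<m} (braid_relators m)"
  have carrier: "carrier (braid_group m) = gwords {1..<m} // ?r"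
    by (simp add: braid_group_def presented_group_def)
  {
    assume "\<exists>\<beta>\<in>carrier (braid_group m). v \<cdot>\<^sub>H \<beta> = w"
    then obtain \<beta> where b: "\<beta> \<in> carrier (braid_group m)" "v \<cdot>\<^sub>H \<beta> = w" by blast
    then obtain u where u: "u \<in> gwords {1..<m}" "\<beta> = ?r `` {u}"
      by (auto simp: carrier elim!: quotientE)
    then have "u \<in> \<beta>" using equiv_class_self[OF equiv_pres_rel] by auto
    then have "w = hurwitz_word v u" using hurwitz_class b assms by blast
    then show "v \<sim> w" using heq_hurwitz_word u m by simp
  next
    assume "v \<sim> w"
    then obtain u where u: "u \<in> gwords {1..<m}" "hurwitz_word v u = w"
      using heq_imp_hurwitz_word m by blast
    have "?r `` {u} \<in> carrier (braid_group m)" using u by (auto simp: carrier intro: quotientI)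
    moreover have "u \<in> ?r `` {u}" using u equiv_class_self[OF equiv_pres_rel] by blast
    ultimately show "\<exists>\<beta>\<in>carrier (braid_group m). v \<cdot>\<^sub>H \<beta> = w"
      using hurwitz_class[OF _ _ assms] u by blast
  }
qed


section \<open>Invariance\<close>

lemma Delta_Nil [simp]: "Delta [] = 0"
  by (simp add: Delta_def)

lemma Delta_Cons [simp]: "Delta (a # v) = a - Delta v"
proof -
  have shift: "Delta v = (\<Sum>i<length v. (- 1) ^ i * v ! i)" for v
    unfolding Delta_def
    by (rule sum.reindex_bij_witness[where i = Suc and j = "\<lambda>i. i - 1"]) auto
  show ?thesis
    by (simp add: shift sum.lessThan_Suc_shift sum_negf del: sum.lessThan_Suc)
qed

lemma Delta_append: "Delta (v @ w) = Delta v + (- 1) ^ length v * Delta w"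
  by (induction v) auto

text \<open>For a trivial tuple all differences are 0 and so is their gcd; the separate case of the
  definition agrees with the general formula.\<close>

lemma tuple_gcd_eq: "tuple_gcd v = Gcd {a - b | a b. a \<in> set v \<and> b \<in> set v}"
proof -
  have e: "{v ! i - v ! j | i j. i < length v \<and> j < length v} = {a - b | a b. a \<in> set v \<and> b \<in> set v}"
    unfolding in_set_conv_nth by blast
  show ?thesis
  proof (cases "trivial_tuple v")
    case True
    then have "{v ! i - v ! j | i j. i < length v \<and> j < length v} \<subseteq> {0}"
      unfolding trivial_tuple_def by (blast intro: right_minus_eq[THEN iffD2])
    then have "Gcd {v ! i - v ! j | i j. i < length v \<and> j < length v} = 0"
      by (rule Gcd_0_iff[THEN iffD2])
    with True show ?thesis by (simp only: tuple_gcd_def e if_True)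
  qed (simp only: tuple_gcd_def e if_False)
qed

lemma tuple_gcd_nonneg [simp]: "0 \<le> tuple_gcd v"
  by (simp add: tuple_gcd_eq)

lemma dvd_tuple_gcd_iff: "k dvd tuple_gcd v \<longleftrightarrow> (\<forall>a\<in>set v. \<forall>b\<in>set v. k dvd a - b)"
  by (auto simp: tuple_gcd_eq dvd_Gcd_iff)

lemma dvd_tuple_gcd_iff_base:
  assumes "c \<in> set v"
  shows "k dvd tuple_gcd v \<longleftrightarrow> (\<forall>a\<in>set v. k dvd a - c)"
proof
  assume r: "\<forall>a\<in>set v. k dvd a - c"
  have "k dvd a - b" if "a \<in> set v" "b \<in> set v" for a b
    using dvd_diff[of k "a - c" "b - c"] r that by simp
  then show "k dvd tuple_gcd v" by (simp add: dvd_tuple_gcd_iff)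
qed (use assms in \<open>auto simp: dvd_tuple_gcd_iff\<close>)

lemma tuple_gcd_dvd: "a \<in> set v \<Longrightarrow> b \<in> set v \<Longrightarrow> tuple_gcd v dvd a - b"
  using dvd_tuple_gcd_iff[of "tuple_gcd v" v] by auto

lemma tuple_gcd_eqI:
  assumes "\<And>k. k dvd tuple_gcd v \<longleftrightarrow> k dvd g" "0 \<le> g"
  shows "tuple_gcd v = g"
  using assms(2) assms(1)[of "tuple_gcd v"] assms(1)[of g]
  by (intro zdvd_antisym_nonneg) auto

lemma cong_class_eq_iff: "cong_class n a = cong_class n b \<longleftrightarrow> [a = b] (mod n)"
  unfolding cong_class_def by (auto simp: cong_def set_eq_iff)

lemma cong_class_eq_iff_dvd: "cong_class n a = cong_class n b \<longleftrightarrow> n dvd a - b"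
  by (simp add: cong_class_eq_iff cong_iff_dvd_diff)

lemma heq_Delta: "v \<sim> w \<Longrightarrow> Delta v = Delta w"
  by (induction rule: hurwitz_eq.induct) (auto simp: Delta_append algebra_simps)

lemma heq_tuple_gcd: "v \<sim> w \<Longrightarrow> tuple_gcd v = tuple_gcd w"
proof (induction rule: hurwitz_eq.induct)
  case (heq_step p a b s)
  \<comment> \<open>The entry \<open>b\<close> survives the step and serves as base point; the only
    other affected entry changes its offset from \<open>a - b\<close> to
    \<open>b - a\<close>.\<close>
  have "k dvd a - b \<longleftrightarrow> k dvd b - a" "2 * b - a - b = b - a" for k
    by (simp_all add: dvd_diff_commute)
  then show ?case
    by (intro tuple_gcd_eqI) (auto simp: dvd_tuple_gcd_iff_base[where c = b])
qed auto

text \<open>An entry \<open>a\<close> becomes \<open>2 * b - a\<close>, a change of 2(b - a), and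
  the gcd d divides b - a. This is where the modulus 2d comes from.\<close>

lemma heq_class_mset: "v \<sim> w \<Longrightarrow> class_mset v = class_mset w"
proof (induction rule: hurwitz_eq.induct)
  case (heq_step p a b s)
  let ?v = "p @ [a, b] @ s" and ?w = "p @ [b, 2 * b - a] @ s"
  have g: "tuple_gcd ?w = tuple_gcd ?v"
    using heq_tuple_gcd[OF hurwitz_eq.heq_step] by metis
  have "tuple_gcd ?v dvd b - a" by (intro tuple_gcd_dvd) auto
  then have "2 * tuple_gcd ?v dvd (2 * b - a) - a"
    using mult_dvd_mono[OF dvd_refl[of 2], of "tuple_gcd ?v" "b - a"] by (simp only: right_diff_distrib) simp
  then have "cong_class (2 * tuple_gcd ?v) (2 * b - a) = cong_class (2 * tuple_gcd ?v) a"
    by (simp add: cong_class_eq_iff_dvd)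
  then show ?case unfolding class_mset_def g by simp
qed auto


section \<open>Pairs of equal entries\<close>

definition double :: "int list \<Rightarrow> int list" where
  "double xs = concat (map (\<lambda>x. [x, x]) xs)"

lemma double_simps [simp]:
  "double [] = []" "double (x # xs) = x # x # double xs" "double (xs @ ys) = double xs @ double ys"
  "set (double xs) = set xs" "length (double xs) = 2 * length xs"
  "mset (double xs) = mset xs + mset xs" "Delta (double xs @ v) = Delta v"
proof -
  show "mset (double xs) = mset xs + mset xs" by (induction xs) (auto simp: double_def)
  show "Delta (double xs @ v) = Delta v" by (induction xs) (auto simp: double_def)
qed (auto simp: double_def length_concat sum_list_triv o_def)

lemma heq_rotate: "[a, b] \<sim> [b, 2 * b - a]"
  using heq_step[of "[]" a b "[]"] by simp

lemma heq_pair_pass: "[a, x, x] \<sim> [x, x, a]"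
proof -
  have "[a, x, x] \<sim> [x, 2 * x - a, x]" using heq_step[of "[]" a x "[x]"] by simp
  also have "\<dots> \<sim> [x, x, a]" using heq_step[of "[x]" "2 * x - a" x "[]"] by simp
  finally show ?thesis .
qed

text \<open>Each \<open>x\<close> is reflected about \<open>a\<close> when it crosses
  \<open>a\<close>; the resulting pair then returns across \<open>a\<close> unchanged.\<close>

lemma heq_pair_reflect: "[x, x, a] \<sim> [2 * a - x, 2 * a - x, a]"
proof -
  have "[x, x, a] \<sim> [x, a, 2 * a - x]" using heq_step[of "[x]" x a "[]"] by simp
  also have "\<dots> \<sim> [a, 2 * a - x, 2 * a - x]" using heq_step[of "[]" x a "[2 * a - x]"] by simp
  also have "\<dots> \<sim> [2 * a - x, 2 * a - x, a]" by (rule heq_pair_pass)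
  finally show ?thesis .
qed

lemma heq_pair_pass_list: "u @ [x, x] \<sim> [x, x] @ u"
proof (induction u)
  case (Cons a u)
  have "(a # u) @ [x, x] \<sim> a # [x, x] @ u" using heq_Cons[OF Cons] by simp
  also have "\<dots> \<sim> [x, x, a] @ u" using heq_append_right[OF heq_pair_pass] by simp
  finally show ?case by simp
qed (simp add: heq_refl)

lemma heq_double_pass: "u @ double xs \<sim> double xs @ u"
proof (induction xs)
  case (Cons x xs)
  have "u @ double (x # xs) \<sim> [x, x] @ u @ double xs"
    using heq_append_right[OF heq_pair_pass_list, of u x "double xs"] by simp
  also have "\<dots> \<sim> [x, x] @ double xs @ u" by (intro heq_append_left Cons)
  finally show ?case by simp
qed (simp add: heq_refl)

lemma heq_double_perm:
  assumes "mset xs = mset ys"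
  shows "double xs \<sim> double ys"
  using assms
proof (induction xs arbitrary: ys)
  case (Cons x xs)
  then have "x \<in> set ys" by (metis list.set_intros(1) mset_eq_setD)
  then obtain p s where ys: "ys = p @ x # s" by (meson split_list)
  have "double (x # xs) \<sim> [x, x] @ double (p @ s)"
    using heq_append_left[OF Cons.IH[of "p @ s"], of "[x, x]"] Cons.prems ys by simp
  also have "\<dots> \<sim> (double p @ [x, x]) @ double s"
    using heq_append_right[OF heq_sym[OF heq_pair_pass_list]] by simp
  finally show ?case by (simp add: ys)
qed (simp add: heq_refl)

text \<open>The pair travels unchanged to an occurrence of \<open>a\<close>, is reflected there, and
  travels back.\<close>

lemma heq_reflect:
  assumes "a \<in> set r"
  shows "[x, x] @ r \<sim> [2 * a - x, 2 * a - x] @ r"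
proof -
  obtain p s where r: "r = p @ a # s" using assms by (meson split_list)
  have pass: "[z, z] @ r \<sim> p @ [z, z, a] @ s" for z
    using heq_append_right[OF heq_sym[OF heq_pair_pass_list[of p z]], of "a # s"] by (simp add: r)
  show ?thesis
    by (rule heq_trans[OF pass heq_trans[OF heq_context[OF heq_pair_reflect] heq_sym[OF pass]]])
qed

text \<open>The generators act on the differences by (p, q) -> (p, q - p) and (p, q) -> (p + q, q).
  Euclid's algorithm ends with one of them zero, that is, with a pair; the last entry
  \<open>a + q\<close> is forced by the alternating sum.\<close>

lemma heq_triple: "[a, a + p, a + p + q] \<sim> [a + q - gcd p q, a + q - gcd p q, a + q]"
proof (induction "nat (\<bar>p\<bar> + \<bar>q\<bar>)" arbitrary: a p q rule: less_induct)
  case less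
  have braid1: "[a, a + p, a + p + q] \<sim> [a + p, a + 2 * p, a + p + q]"
    using heq_step[of "[]" a "a + p" "[a + p + q]"] by (simp add: algebra_simps)
  have braid1_inv: "[a - p, a, a + p + q] \<sim> [a, a + p, a + p + q]"
    using heq_step[of "[]" "a - p" a "[a + p + q]"] by (simp add: algebra_simps)
  have braid2: "[a, a + p, a + p + q] \<sim> [a, a + p + q, a + p + 2 * q]"
    using heq_step[of "[a]" "a + p" "a + p + q" "[]"] by (simp add: algebra_simps)
  have braid2_inv: "[a, a + p - q, a + p] \<sim> [a, a + p, a + p + q]"
    using heq_step[of "[a]" "a + p - q" "a + p" "[]"] by (simp add: algebra_simps)
  have g: "gcd p (q - p) = gcd p q" "gcd p (q + p) = gcd p q" "gcd (p + q) q = gcd p q" "gcd (p - q) q = gcd p q"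
    using gcd_diff1[of q p] gcd_add1[of q p] gcd_add1[of p q] gcd_diff1[of p q]
    by (simp_all only: gcd.commute)
  \<comment> \<open>For nonzero p and q of equal sign, subtracting the one of smaller absolute value
    from the other lowers |p| + |q|; for opposite signs, adding it does.\<close>
  consider "p = 0" | "q = 0" | "p \<noteq> 0" "q \<noteq> 0" "\<bar>q - p\<bar> < \<bar>q\<bar>" | "p \<noteq> 0" "q \<noteq> 0" "\<bar>q + p\<bar> < \<bar>q\<bar>"
    | "p \<noteq> 0" "q \<noteq> 0" "\<bar>p + q\<bar> < \<bar>p\<bar>" | "p \<noteq> 0" "q \<noteq> 0" "\<bar>p - q\<bar> < \<bar>p\<bar>" by linarith
  then show ?case
  proof cases
    case 1
    show ?thesis
    proof (cases "q \<ge> 0")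
      case False
      then show ?thesis using heq_pair_reflect[of a "a + q"] 1 by (simp add: algebra_simps)
    qed (simp add: 1 heq_refl)
  next
    case 2
    have n: "[a, a + p, a + p] \<sim> [a + p, a + p, a]" by (rule heq_pair_pass)
    show ?thesis
    proof (cases "p \<ge> 0")
      case True
      then show ?thesis using heq_trans[OF n heq_pair_reflect[of "a + p" a]] 2
        by (simp add: algebra_simps)
    qed (use n 2 in simp)
  next
    case 3
    then show ?thesis using less(1)[of p "q - p" "a + p"] heq_trans[OF braid1] g by (simp add: algebra_simps)
  next
    case 4
    then show ?thesis using less(1)[of p "q + p" "a - p"] heq_trans[OF heq_sym[OF braid1_inv]] g by (simp add: algebra_simps)
  next
    case 5
    then show ?thesis using less(1)[of "p + q" "q" "a"] heq_trans[OF braid2] g by (simp add: algebra_simps)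
  next
    case 6
    then show ?thesis using less(1)[of "p - q" "q" "a"] heq_trans[OF heq_sym[OF braid2_inv]] g by (simp add: algebra_simps)
  qed
qed

text \<open>Entries are added at the front one at a time. Each passes the pairs, and once three
  entries are unpaired, \<open>heq_triple\<close> makes two of them equal.\<close>

lemma heq_double_append:
  assumes "v \<noteq> []"
  shows "\<exists>xs r. v \<sim> double xs @ r \<and> length r \<in> {1, 2}"
  using assms
proof (induction v rule: list_nonempty_induct)
  case (single a)
  show ?case by (intro exI[of _ "[]"] exI[of _ "[a]"]) (simp add: heq_refl)
next
  case (cons a v)
  then obtain xs r where r: "v \<sim> double xs @ r" "length r \<in> {1, 2}" by blast
  have "a # v \<sim> [a] @ double xs @ r" using heq_Cons[OF r(1)] by simp
  also have "\<dots> \<sim> double xs @ [a] @ r"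
    using heq_append_right[OF heq_double_pass[of "[a]"]] by simp
  finally have v: "a # v \<sim> double xs @ a # r" by simp
  show ?case
  proof (cases "length r = 1")
    case True
    with v show ?thesis by (intro exI[of _ xs] exI[of _ "a # r"]) simp
  next
    case False
    then obtain b c where "r = [b, c]" using r(2) by (auto simp: length_Suc_conv numeral_2_eq_2)
    then have "a # r \<sim> [a + (c - b) - gcd (b - a) (c - b), a + (c - b) - gcd (b - a) (c - b), a + (c - b)]"
      using heq_triple[of a "b - a" "c - b"] by simp
    from heq_trans[OF v heq_append_left[OF this, of "double xs"]]
    show ?thesis
      by (intro exI[of _ "xs @ [a + (c - b) - gcd (b - a) (c - b)]"] exI[of _ "[a + (c - b)]"]) simp
  qed
qed


section \<open>Tuples of odd length\<close>

lemma heq_double_append_perm: "mset xs = mset ys \<Longrightarrow> double xs @ r \<sim> double ys @ r"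
  by (intro heq_append_right heq_double_perm)

lemma heq_double_extract:
  assumes "x \<in> set xs"
  obtains zs where "mset xs = mset (x # zs)" "double xs @ r \<sim> x # x # double zs @ r"
proof
  show "mset xs = mset (x # remove1 x xs)" using assms by simp
  from heq_double_append_perm[OF this]
  show "double xs @ r \<sim> x # x # double (remove1 x xs) @ r" by simp
qed

lemma heq_double_abs: "double xs @ [y] \<sim> double (map (\<lambda>x. y + \<bar>x - y\<bar>) xs) @ [y]"
proof (induction xs)
  case (Cons x xs)
  let ?r = "double (map (\<lambda>x. y + \<bar>x - y\<bar>) xs) @ [y]"
  have "double (x # xs) @ [y] \<sim> [x, x] @ ?r" using heq_append_left[OF Cons, of "[x, x]"] by simp
  also have "\<dots> \<sim> [y + \<bar>x - y\<bar>, y + \<bar>x - y\<bar>] @ ?r"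
    using heq_reflect[of y ?r x] by (cases "x \<ge> y") (auto simp: heq_refl)
  finally show ?case by simp
qed (simp add: heq_refl)

text \<open>Euclid's algorithm on the offsets from \<open>y\<close>: reflecting about \<open>x'\<close> and then about \<open>y\<close>
  changes an offset by twice the offset of \<open>x'\<close>.\<close>

lemma heq_double_euclid_nonneg:
  assumes "\<forall>x\<in>set xs. y \<le> x"
  shows "\<exists>ys g. 0 \<le> g \<and> double xs @ [y] \<sim> double ys @ [y] \<and> set ys \<subseteq> {y, y + g}"
  using assms
proof (induction "\<Sum>x\<in>#mset xs. nat (x - y)" arbitrary: xs rule: less_induct)
  case less
  show ?case
  proof (cases "\<exists>x\<in>set xs. \<exists>x'\<in>set xs. y < x' \<and> x' < x")
    case True
    then obtain x x' where x: "x \<in> set xs" "x' \<in> set xs" "y < x'" "x' < x" by blast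
    define zs where "zs = remove1 x' (remove1 x xs)"
    \<comment> \<open>The reflection of \<open>x\<close> about \<open>x'\<close>, reflected again
      about \<open>y\<close> if it fell below \<open>y\<close>. As \<open>x'\<close> lies strictly
      between \<open>y\<close> and \<open>x\<close>, this is closer to \<open>y\<close> than
      \<open>x\<close> was, so the sum of offsets drops.\<close>
    define z where "z = y + \<bar>2 * x' - x - y\<bar>"
    let ?ys = "z # x' # zs"
    have m: "mset xs = mset (x # x' # zs)"
    proof -
      have remove: "mset ys = mset (z # remove1 z ys)" if "z \<in> set ys" for z ys
        using that by simp
      have "mset (remove1 x xs) = mset (x' # zs)"
        unfolding zs_def by (rule remove) (use x in simp)
      with remove[OF x(1)] show ?thesis by simp
    qed
    then have s: "set xs = set (x # x' # zs)" by (metis mset_eq_setD)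
    have "double xs @ [y] \<sim> [x, x] @ double (x' # zs) @ [y]"
      using heq_double_append_perm[OF m] by simp
    also have "\<dots> \<sim> [z, z] @ double (x' # zs) @ [y]"
    proof (cases "2 * x' - x \<ge> y")
      case True
      then show ?thesis using heq_reflect[of x' "double (x' # zs) @ [y]" x] by (simp add: z_def)
    next
      case False
      have "[x, x] @ double (x' # zs) @ [y] \<sim> [2 * x' - x, 2 * x' - x] @ double (x' # zs) @ [y]"
        by (intro heq_reflect) simp
      also have "\<dots> \<sim> [2 * y - (2 * x' - x), 2 * y - (2 * x' - x)] @ double (x' # zs) @ [y]"
        by (intro heq_reflect) simp
      finally show ?thesis using False by (simp add: z_def algebra_simps)
    qed
    finally have h: "double xs @ [y] \<sim> double ?ys @ [y]" by simp
    have "nat (z - y) < nat (x - y)" using x by (auto simp: z_def)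
    then have "(\<Sum>x\<in>#mset ?ys. nat (x - y)) < (\<Sum>x\<in>#mset xs. nat (x - y))" unfolding m by simp
    moreover have "\<forall>x\<in>set ?ys. y \<le> x" using less.prems s by (auto simp: z_def)
    ultimately obtain ys g where "0 \<le> g" "double ?ys @ [y] \<sim> double ys @ [y]" "set ys \<subseteq> {y, y + g}"
      using less.hyps by blast
    then show ?thesis using heq_trans[OF h] by blast
  next
    case False
    show ?thesis
    proof (cases "\<exists>x\<in>set xs. y < x")
      case True
      then obtain x where x: "x \<in> set xs" "y < x" by blast
      \<comment> \<open>No two distinct values above \<open>y\<close> remain, so \<open>x\<close> is
        the only one and \<open>x - y\<close> is the offset sought.\<close>
      have "set xs \<subseteq> {y, x}"
      proof
        fix a assume "a \<in> set xs"
        then have "y \<le> a" "\<not> (y < a \<and> a < x)" "\<not> x < a" using False less.prems x by blast+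
        then show "a \<in> {y, x}" by auto
      qed
      then show ?thesis using x by (intro exI[of _ xs] exI[of _ "x - y"]) (simp add: heq_refl)
    next
      case False
      then have "set xs \<subseteq> {y}" using less.prems by force
      then show ?thesis by (intro exI[of _ xs] exI[of _ 0]) (simp add: heq_refl)
    qed
  qed
qed

lemma heq_odd_normal_form:
  assumes "odd (length v)"
  obtains xs where "v \<sim> double xs @ [Delta v]" "set xs \<subseteq> {Delta v, Delta v + tuple_gcd v}"
proof -
  obtain us r where v: "v \<sim> double us @ r" "length r \<in> {1, 2}"
    using heq_double_append[of v] assms by fastforce
  have "length r = 1" using heq_length[OF v(1)] v(2) assms by auto
  then obtain y where r: "r = [y]" by (auto simp: length_Suc_conv)
  have y: "y = Delta v" using heq_Delta[OF v(1)] r by simp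
  have "\<forall>x\<in>set (map (\<lambda>x. y + \<bar>x - y\<bar>) us). y \<le> x" by simp
  then obtain xs g where g: "0 \<le> g" "set xs \<subseteq> {y, y + g}"
    and "double (map (\<lambda>x. y + \<bar>x - y\<bar>) us) @ [y] \<sim> double xs @ [y]"
    using heq_double_euclid_nonneg by blast
  with v(1) have h: "v \<sim> double xs @ [y]" unfolding r using heq_double_abs heq_trans by blast
  have "set xs \<subseteq> {y, y + tuple_gcd v}"
  \<comment> \<open>If \<open>y + g\<close> occurs, then \<open>g\<close> is the gcd of the normal
    form; otherwise every pair sits at \<open>y\<close> and the inclusion is immediate.\<close>
  proof (cases "y + g \<in> set xs")
    case True
    have "tuple_gcd (double xs @ [y]) = g"
      using True g by (intro tuple_gcd_eqI) (auto simp: dvd_tuple_gcd_iff_base[where c = y])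
    then show ?thesis using heq_tuple_gcd[OF h] g by simp
  qed (use g in auto)
  then show ?thesis using that h y by blast
qed

lemma multiset_double_cancel: "A + A = B + B \<Longrightarrow> A = (B :: 'a multiset)"
proof (rule multiset_eqI)
  fix x assume "A + A = B + B"
  then have "count (A + A) x = count (B + B) x" by simp
  then show "count A x = count B x" by simp
qed

text \<open>Both normal forms end in the same entry and draw their pairs from the same two values,
  so only the multiplicities have to be compared.\<close>

lemma heq_odd:
  assumes "odd (length v)" "length v = length w"
    and D: "Delta v = Delta w" and g: "tuple_gcd v = tuple_gcd w" and M: "class_mset v = class_mset w"
  shows "v \<sim> w"
proof -
  define y d where "y = Delta v" and "d = tuple_gcd v"
  obtain xs where xs: "v \<sim> double xs @ [y]" "set xs \<subseteq> {y, y + d}"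
    using heq_odd_normal_form[OF assms(1)] unfolding y_def d_def by blast
  obtain zs where zs: "w \<sim> double zs @ [y]" "set zs \<subseteq> {y, y + d}"
    using heq_odd_normal_form[of w] assms(1) unfolding y_def d_def D g assms(2) by blast
  let ?c = "cong_class (2 * d)"
  have "class_mset (double xs @ [y]) = class_mset (double zs @ [y])"
    using M heq_class_mset[OF xs(1)] heq_class_mset[OF zs(1)] by metis
  moreover have "tuple_gcd (double xs @ [y]) = d" "tuple_gcd (double zs @ [y]) = d"
    using heq_tuple_gcd[OF xs(1)] heq_tuple_gcd[OF zs(1)] g d_def by metis+
  ultimately have "image_mset ?c (mset (double xs @ [y])) = image_mset ?c (mset (double zs @ [y]))"
    unfolding class_mset_def by (simp only:)
  then have "image_mset ?c (mset xs) + image_mset ?c (mset xs) = image_mset ?c (mset zs) + image_mset ?c (mset zs)"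
    by simp
  then have "image_mset ?c (mset xs) = image_mset ?c (mset zs)"
    by (rule multiset_double_cancel)
  \<comment> \<open>The two values differ by d, which 2d divides only for d = 0, and then they
    coincide.\<close>
  moreover have "inj_on ?c {y, y + d}"
    unfolding inj_on_def cong_class_eq_iff_dvd by auto
  then have "a = b" if "a \<in># mset xs" "b \<in># mset zs" "?c a = ?c b" for a b
    using inj_onD[of ?c "{y, y + d}" a b] that xs(2) zs(2) by auto
  ultimately have "mset xs = mset zs"
    using multiset.inj_map_strong[of "mset xs" "mset zs" ?c ?c] by blast
  then show ?thesis
    using heq_trans[OF xs(1) heq_trans[OF heq_double_append_perm heq_sym[OF zs(1)]]] by blast
qed


section \<open>Tuples of even length\<close>

text \<open>A repeated first entry makes the condition on the gcd automatic, see \<open>splits_pair\<close>.\<close>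

definition splits :: "int \<Rightarrow> int list \<Rightarrow> bool" where
  "splits x v \<longleftrightarrow> (\<exists>v'. v \<sim> x # v' \<and> tuple_gcd v' = tuple_gcd v)"

lemma splits_pair:
  assumes "v \<sim> x # x # r"
  shows "splits x v"
proof -
  \<comment> \<open>The gcd depends only on the set of entries, and the second \<open>x\<close> does
    not enlarge it.\<close>
  have "tuple_gcd (x # r) = tuple_gcd (x # x # r)" by (simp add: tuple_gcd_eq)
  then show ?thesis using assms heq_tuple_gcd[OF assms] unfolding splits_def by metis
qed

lemma splits_normal_form:
  assumes "splits x v" "even (length v)" "4 \<le> length v"
  obtains xs where "v \<sim> x # double xs @ [x - Delta v]"
    "set xs \<subseteq> {x - Delta v, x - Delta v + tuple_gcd v}" "x - Delta v + tuple_gcd v \<in> set xs"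
    "tuple_gcd v dvd Delta v"
proof -
  obtain v' where v': "v \<sim> x # v'" "tuple_gcd v' = tuple_gcd v"
    using assms(1) by (auto simp: splits_def)
  have l: "length v = Suc (length v')" and D: "Delta v' = x - Delta v"
    using heq_length[OF v'(1)] heq_Delta[OF v'(1)] by auto
  obtain xs where xs: "v' \<sim> double xs @ [x - Delta v]"
    "set xs \<subseteq> {x - Delta v, x - Delta v + tuple_gcd v}"
    using heq_odd_normal_form[of v'] l assms(2) unfolding v'(2) D by auto
  have h: "v \<sim> x # double xs @ [x - Delta v]" using heq_trans[OF v'(1) heq_Cons[OF xs(1)]] .
  have "xs \<noteq> []" using heq_length[OF h] assms(3) by auto
  have "x - Delta v + tuple_gcd v \<in> set xs"
  \<comment> \<open>Otherwise the tail is constant, so d = 0. The missing value is then the only one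
    allowed in \<open>xs\<close>, so \<open>xs\<close> would be empty, contrary to length at least
    4.\<close>
  proof (rule ccontr)
    assume n: "x - Delta v + tuple_gcd v \<notin> set xs"
    then have "set xs \<subseteq> {x - Delta v}" using xs(2) by blast
    then have "tuple_gcd (double xs @ [x - Delta v]) = 0" 
      by (intro tuple_gcd_eqI) (auto simp: dvd_tuple_gcd_iff_base[where c = "x - Delta v"])
    then have "tuple_gcd v = 0" using heq_tuple_gcd[OF xs(1)] v'(2) by simp
    with xs(2) n have "set xs = {}" by (auto simp: subset_singleton_iff)
    with \<open>xs \<noteq> []\<close> show False by simp
  qed
  \<comment> \<open>The first and the last entry of the normal form differ by
    \<open>Delta v\<close>.\<close>
  moreover have "tuple_gcd v dvd x - (x - Delta v)"
    unfolding heq_tuple_gcd[OF h] by (rule tuple_gcd_dvd) auto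
  ultimately show ?thesis using that h xs(2) by simp
qed

text \<open>Put y = x - Delta v. With \<open>x\<close> moved behind the pairs, the pair at y + d can
  be reflected about both x and y. The pairs at y + d, y - d and their reflections about x realize
  the four sign choices.\<close>

lemma splits_shift:
  assumes "splits x v" "even (length v)" "4 \<le> length v"
    and "s \<in> {1, - 1}" "t \<in> {1, - 1}"
  shows "splits (x + s * Delta v + t * tuple_gcd v) v"
proof -
  define y d where "y = x - Delta v" and "d = tuple_gcd v"
  obtain xs where nf: "v \<sim> x # double xs @ [x - Delta v]" "x - Delta v + tuple_gcd v \<in> set xs"
    by (rule splits_normal_form[OF assms(1-3)])
  then have xs: "v \<sim> [x] @ double xs @ [y]" "y + d \<in> set xs" by (simp_all add: y_def d_def)
  obtain zs where "double xs @ [x, y] \<sim> (y + d) # (y + d) # double zs @ [x, y]"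
    using heq_double_extract[OF xs(2)] by blast
  then have zs: "double xs @ [x, y] \<sim> [y + d, y + d] @ double zs @ [x, y]" by simp
  have "[x] @ double xs @ [y] \<sim> double xs @ [x, y]"
    using heq_append_right[OF heq_double_pass[of "[x]" xs], of "[y]"] by simp
  from heq_trans[OF heq_trans[OF xs(1) this] zs]
  have v: "v \<sim> [y + d, y + d] @ double zs @ [x, y]" .
  have r: "v \<sim> [2 * a - b, 2 * a - b] @ double zs @ [x, y]"
    if "v \<sim> [b, b] @ double zs @ [x, y]" "a \<in> {x, y}" for a b
    by (rule heq_trans[OF that(1) heq_reflect]) (use that(2) in auto)
  have pair: "splits b v" if "v \<sim> [b, b] @ double zs @ [x, y]" for b
    using splits_pair that by simp
  have vy: "v \<sim> [2 * y - (y + d), 2 * y - (y + d)] @ double zs @ [x, y]"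
    and vx: "v \<sim> [2 * x - (y + d), 2 * x - (y + d)] @ double zs @ [x, y]"
    by (rule r[OF v]; simp)+
  have vyx: "v \<sim> [2 * x - (2 * y - (y + d)), 2 * x - (2 * y - (y + d))] @ double zs @ [x, y]"
    by (rule r[OF vy]) simp
  have "splits (x + (- 1) * Delta v + 1 * d) v" using pair[OF v] by (simp add: y_def)
  moreover have "splits (x + (- 1) * Delta v + (- 1) * d) v" using pair[OF vy] by (simp add: y_def algebra_simps)
  moreover have "splits (x + 1 * Delta v + (- 1) * d) v" using pair[OF vx] by (simp add: y_def algebra_simps)
  moreover have "splits (x + 1 * Delta v + 1 * d) v" using pair[OF vyx] by (simp add: y_def algebra_simps)
  moreover have "s = 1 \<and> t = 1 \<or> s = 1 \<and> t = - 1 \<or> s = - 1 \<and> t = 1 \<or> s = - 1 \<and> t = - 1"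
    using assms(4,5) by blast
  ultimately show ?thesis unfolding d_def by (elim disjE conjE) (simp_all only:)
qed

text \<open>Two shifts with opposite signs at \<open>Delta v\<close> and equal signs at d add up to
  2d or -2d.\<close>

lemma splits_shift_double:
  assumes "splits x v" "even (length v)" "4 \<le> length v"
  shows "splits (x + 2 * k * tuple_gcd v) v"
proof (induction k rule: int_induct[where k = 0])
  case base
  show ?case using assms by simp
next
  case (step1 k)
  from splits_shift[OF splits_shift[OF step1(2) assms(2,3), of 1 1] assms(2,3), of "- 1" 1]
  show ?case by (simp add: algebra_simps)
next
  case (step2 k)
  from splits_shift[OF splits_shift[OF step2(2) assms(2,3), of 1 "- 1"] assms(2,3), of "- 1" "- 1"]
  show ?case by (simp add: algebra_simps)
qed

text \<open>Here \<open>Delta v\<close> is an odd multiple of d, so \<open>splits_shift\<close>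
  never leaves the class of \<open>x\<close> modulo 2d. The last entry y = x - Delta v is one member
  of the other class; a second can only come from a pair, which must then sit at y.\<close>

lemma splits_other_class:
  assumes "splits x v" "even (length v)" "4 \<le> length v"
    and odd: "\<not> 2 * tuple_gcd v dvd Delta v"
    and count: "2 \<le> count (class_mset v) (cong_class (2 * tuple_gcd v) (x - Delta v))"
  shows "splits (x - Delta v) v"
proof -
  define y d where "y = x - Delta v" and "d = tuple_gcd v"
  obtain xs where nf: "v \<sim> x # double xs @ [x - Delta v]" "set xs \<subseteq> {x - Delta v, x - Delta v + tuple_gcd v}"
    by (rule splits_normal_form[OF assms(1-3)])
  then have xs: "v \<sim> [x] @ double xs @ [y]" "set xs \<subseteq> {y, y + d}" by (simp_all add: y_def d_def)
  let ?c = "cong_class (2 * d)"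
  have "class_mset v = image_mset ?c (mset ([x] @ double xs @ [y]))"
    unfolding heq_class_mset[OF xs(1)] unfolding class_mset_def d_def heq_tuple_gcd[OF xs(1)] ..
  moreover have "?c x \<noteq> ?c y" using odd by (simp add: cong_class_eq_iff_dvd y_def d_def)
  ultimately have "count (class_mset v) (?c y)
      = count (image_mset ?c (mset xs)) (?c y) + count (image_mset ?c (mset xs)) (?c y) + 1" by simp
  with count have "0 < count (image_mset ?c (mset xs)) (?c y)"
    unfolding y_def[symmetric] d_def[symmetric] by linarith
  then have "?c y \<in> ?c ` set xs" unfolding count_greater_zero_iff by simp
  then obtain b where b: "b \<in> set xs" "?c b = ?c y" by (metis imageE)
  have "b = y"
  proof (rule ccontr)
    assume "b \<noteq> y"
    then have "b = y + d" using b xs(2) by auto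
    with b(2) have "2 * d dvd d" by (simp add: cong_class_eq_iff_dvd)
    with \<open>b = y + d\<close> \<open>b \<noteq> y\<close> show False by auto
  qed
  then obtain zs where zs: "double xs @ [x, y] \<sim> y # y # double zs @ [x, y]"
    using heq_double_extract b(1) by blast
  have "[x] @ double xs @ [y] \<sim> double xs @ [x, y]"
    using heq_append_right[OF heq_double_pass[of "[x]" xs], of "[y]"] by simp
  from splits_pair[OF heq_trans[OF heq_trans[OF xs(1) this] zs]] show ?thesis by (simp add: y_def)
qed

text \<open>Write x' - x = dk and Delta v = dl. For even k, shifts by 2d suffice. For odd k and even
  l, a shift by Delta v + d first reaches the class of x'. For k and l odd, x' lies in the class of
  x - Delta v, and the multiplicity hypothesis gives access to it.\<close>

lemma splits_class:
  assumes "splits x v" "even (length v)" "4 \<le> length v"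
    and x': "tuple_gcd v dvd x' - x"
    and count: "2 \<le> count (class_mset v) (cong_class (2 * tuple_gcd v) x')"
  shows "splits x' v"
proof -
  define d where "d = tuple_gcd v"
  have even_step: "splits b v" if "splits a v" "2 * d dvd b - a" for a b
  proof -
    from that(2) obtain k where "b - a = 2 * d * k" ..
    then have "b = a + 2 * k * tuple_gcd v" by (simp add: d_def algebra_simps)
    then show ?thesis using splits_shift_double[OF that(1) assms(2,3)] by simp
  qed
  have "d dvd Delta v" using splits_normal_form[OF assms(1-3)] unfolding d_def by blast
  then obtain l where l: "Delta v = d * l" ..
  from x' obtain k where k: "x' - x = d * k" unfolding d_def ..
  consider "even k" | "odd k" "even l" | "odd k" "odd l" by blast
  then show ?thesis
  proof cases
    case 1
    then have "2 * d dvd x' - x" using k by auto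
    then show ?thesis using even_step assms(1) by blast
  next
    case 2
    have "x' - (x + 1 * Delta v + 1 * d) = d * (k - l - 1)" using k l by (simp add: algebra_simps)
    moreover have "2 dvd k - l - 1" using 2 by simp
    ultimately have "2 * d dvd x' - (x + 1 * Delta v + 1 * d)" by (auto simp: mult.commute)
    then show ?thesis
      using even_step splits_shift[OF assms(1-3), of 1 1] by (simp add: d_def)
  next
    case 3
    have "x' - (x - Delta v) = d * (k + l)" using k l by (simp add: algebra_simps)
    moreover have "2 dvd k + l" using 3 by simp
    ultimately have e: "2 * d dvd x' - (x - Delta v)" by (auto simp: mult.commute)
    show ?thesis
    proof (cases "d = 0")
      case True
      then show ?thesis using k assms(1) by simp
    next
      case False
      have "cong_class (2 * d) (x - Delta v) = cong_class (2 * d) x'"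
        using e by (simp add: cong_class_eq_iff_dvd dvd_diff_commute)
      moreover have "\<not> 2 * d dvd Delta v" using 3 l False by simp
      ultimately have "splits (x - Delta v) v"
        using splits_other_class[OF assms(1-3)] count by (simp add: d_def)
      then show ?thesis using even_step e by blast
    qed
  qed
qed

lemma exists_pair:
  assumes "3 \<le> length v"
  obtains x r where "v \<sim> x # x # r"
proof -
  obtain xs r where v: "v \<sim> double xs @ r" "length r \<in> {1, 2}"
    using heq_double_append[of v] assms by fastforce
  then have "xs \<noteq> []" using heq_length[OF v(1)] assms by auto
  then show ?thesis using v(1) that by (cases xs) auto
qed

text \<open>Since \<open>v\<close> is equivalent to a tuple starting with the pair
  \<open>x, x\<close>, the class of \<open>x\<close> has multiplicity at least two in the common
  multiset. This is what allows the same \<open>x\<close> to be split off from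
  \<open>w\<close>.\<close>

lemma heq_even:
  assumes "even (length v)" "4 \<le> length v" "length v = length w"
    and D: "Delta v = Delta w" and g: "tuple_gcd v = tuple_gcd w" and M: "class_mset v = class_mset w"
  shows "v \<sim> w"
proof -
  define d where "d = tuple_gcd v"
  let ?c = "cong_class (2 * d)"
  obtain x r where v: "v \<sim> x # x # r" using exists_pair[of v] assms by auto
  obtain x0 r0 where w: "w \<sim> x0 # x0 # r0" using exists_pair[of w] assms by auto
  have "class_mset w = image_mset ?c (mset (x # x # r))"
    unfolding M[symmetric] heq_class_mset[OF v] unfolding class_mset_def d_def heq_tuple_gcd[OF v] ..
  then have count: "2 \<le> count (class_mset w) (?c x)" by simp
  have "?c x \<in># class_mset w" using count by (intro count_inI) simp
  then have "?c x \<in># class_mset (x0 # x0 # r0)" using heq_class_mset[OF w] by simp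
  then obtain b where b: "b \<in> set (x0 # x0 # r0)" "?c x = ?c b"
    using heq_tuple_gcd[OF w] g by (auto simp: class_mset_def d_def)
  \<comment> \<open>Modulo d, \<open>x\<close> agrees with \<open>b\<close> and \<open>b\<close>
    with \<open>x0\<close>, so the congruence required by \<open>splits_class\<close>
    follows.\<close>
  have "d dvd b - x0" unfolding d_def g heq_tuple_gcd[OF w] using b(1) by (intro tuple_gcd_dvd) auto
  moreover have "d dvd x - b"
    using b(2) dvd_mult_right[of 2 d "x - b"] dvd_trans[of d "2 * d"] by (simp add: cong_class_eq_iff_dvd)
  ultimately have "d dvd (x - b) + (b - x0)" by (intro dvd_add)
  then have "splits x w"
    using splits_class[OF splits_pair[OF w], of x] count assms by (simp add: d_def)
  then obtain w' where w': "w \<sim> x # w'" "tuple_gcd w' = d" by (auto simp: splits_def d_def g)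
  obtain v' where v': "v \<sim> x # v'" "tuple_gcd v' = d"
    using splits_pair[OF v] by (auto simp: splits_def d_def)
  \<comment> \<open>Cancelling the class of the common first entry leaves the class multisets of the
    tails, because the tails still have gcd d.\<close>
  have "image_mset ?c (mset (x # v')) = image_mset ?c (mset (x # w'))"
    using heq_class_mset[OF v'(1)] heq_class_mset[OF w'(1)] heq_tuple_gcd[OF v'(1)]
      heq_tuple_gcd[OF w'(1)] M g by (simp add: class_mset_def d_def)
  then have "class_mset v' = class_mset w'" using v'(2) w'(2) by (simp add: class_mset_def)
  then have "v' \<sim> w'"
    using heq_length[OF v'(1)] heq_length[OF w'(1)] heq_Delta[OF v'(1)] heq_Delta[OF w'(1)]
      assms v'(2) w'(2) by (intro heq_odd) auto
  then show ?thesis using heq_trans[OF v'(1) heq_trans[OF heq_Cons heq_sym[OF w'(1)]]] by blast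
qed

section \<open>Tuples of length two\<close>

lemma heq_rotate_nat: "[a, a + p] \<sim> [a + int n * p, a + int n * p + p]"
proof (induction n)
  case (Suc n)
  from heq_trans[OF Suc heq_rotate] show ?case by (simp add: algebra_simps)
qed (simp add: heq_refl)

lemma heq_rotate_int: "[a, a + p] \<sim> [a + k * p, a + k * p + p]"
proof (cases "k \<ge> 0")
  case True
  then show ?thesis using heq_rotate_nat[of a p "nat k"] by simp
next
  case False
  then show ?thesis using heq_sym[OF heq_rotate_nat[of "a + k * p" p "nat (- k)"]] by simp
qed

text \<open>Splitting off an entry would leave a tail with gcd 0, so this length is treated
  directly. The generator translates both entries by b - a, a difference fixed by
  \<open>Delta\<close>, and the class multiset makes a' congruent to a or b modulo it.\<close>

lemma heq_two:
  assumes "length v = 2" "length w = 2"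
    and D: "Delta v = Delta w" and g: "tuple_gcd v = tuple_gcd w" and M: "class_mset v = class_mset w"
  shows "v \<sim> w"
proof -
  obtain a b a' b' where v: "v = [a, b]" and w: "w = [a', b']"
    using assms(1,2) by (auto simp: numeral_2_eq_2 length_Suc_conv)
  define d where "d = tuple_gcd v"
  have "b - a dvd d" by (simp add: d_def v dvd_tuple_gcd_iff_base[where c = a])
  have "cong_class (2 * d) a' \<in># class_mset w" by (simp add: w class_mset_def d_def v g[unfolded v w])
  then have "cong_class (2 * d) a' \<in># class_mset v" using M by simp
  then have "2 * d dvd a' - a \<or> 2 * d dvd a' - b"
    by (auto simp: v class_mset_def d_def cong_class_eq_iff_dvd)
  then have "b - a dvd a' - a \<or> b - a dvd a' - b"
    using \<open>b - a dvd d\<close> by (meson dvd_trans dvd_triv_right)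
  \<comment> \<open>Either match will do, since \<open>a\<close> and \<open>b\<close> agree modulo
    \<open>b - a\<close>.\<close>
  moreover have "b - a dvd a' - a" if "b - a dvd a' - b"
    using dvd_add[OF that dvd_refl] by simp
  ultimately obtain k where "a' - a = (b - a) * k" by blast
  then have "a' = a + k * (b - a)" by (simp add: algebra_simps)
  moreover have "b' = a' + (b - a)" using D by (simp add: v w)
  ultimately show ?thesis using heq_rotate_int[of a "b - a" k] by (simp add: v w)
qed

theorem theorem1p1:
  fixes m :: nat and v w :: "int list"
  assumes "m \<ge> 2" and "v \<in> rinf_pow m" and "w \<in> rinf_pow m"
  shows "(\<exists>\<beta>\<in>carrier (braid_group m). v \<cdot>\<^sub>H \<beta> = w)
     \<longleftrightarrow> (Delta v = Delta w \<and> tuple_gcd v = tuple_gcd w \<and> class_mset v = class_mset w)"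
proof -
  have l: "length v = m" "length w = m" using assms by (auto simp: rinf_pow_def)
  consider "odd m" | "even m" "4 \<le> m" | "m = 2" using assms(1) by (cases "m = 3") force+
  then have "v \<sim> w" if "Delta v = Delta w" "tuple_gcd v = tuple_gcd w" "class_mset v = class_mset w"
    using that l by cases (auto intro: heq_odd heq_even heq_two)
  then show ?thesis
    unfolding hurwitz_orbit_iff_heq[OF assms(2)]
    using heq_Delta heq_tuple_gcd heq_class_mset by blast
qed

end
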